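(* Let $X$ be a path-connected topological space, $x_0\in X$, $A\subset X$ a subspace, and $f\colon X\to X$ a continuous map. Then the weak category of $f$ reduced to $A$ equals $$c^\ast_A(f)=\lim_{k\to\infty}\mathrm{D}_X(A;f^k,x_0),$$ where $f^k$ is the $k$-th iterate of $f$ and $x_0$ also denotes the constant map $X\to X$ with value $x_0$.
   Context: Weak category (normalized): $c^\ast_A(f)$ is the smallest integer $n\geq 0$ such that $A=U_0\cup\dots\cup U_n$, where the $U_i$ are open in $A$ and, for each $i$, the restriction ${f^{k_i}}_{|U_i}\colon U_i\to X$ is null-homotopic (homotopic to a constant map) for some $k_i$; it is $\infty$ if there is no such covering. Homotopic distance: for continuous maps $u,v\colon Z\to Y$, $\mathrm{D}(u,v)$ is the least integer $n\geq 0$ such that there is an open covering $U_0\cup\dots\cup U_n=Z$ for which the restrictions $u_{|U_j}$ and $v_{|U_j}$ are homotopic as maps $U_j\to Y$, for all $j$; if there is no such covering, $\mathrm{D}(u,v)=\infty$. Subspace distance: for $u,v\colon X\to Y$ and a subspace $A\subset X$, $\mathrm{D}_X(A;u,v):=\mathrm{D}(u_{|A},v_{|A})$. The limit is taken in $\{0,1,2,\dots\}\cup\{\infty\}$. *)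

theory Defs
  imports "HOL-Analysis.Analysis"
begin

text \<open>
  Both invariants take values in \<^typ>\<open>enat\<close>, where the infimum of the empty set is \<open>\<infinity>\<close>; so the
  value is \<open>\<infinity>\<close> precisely when no open covering of the required kind exists, and otherwise it is
  the least admissible \<open>n\<close>. Coverings consist of \<open>n + 1\<close> possibly empty sets \<open>U 0, \<dots>, U n\<close>; the
  values \<open>U i\<close> for \<open>i > n\<close> are irrelevant. Restriction of a map to \<open>U\<close> is expressed by
  restricting the source topology.
\<close>

definition homotopic_distance ::
    "'a topology \<Rightarrow> 'b topology \<Rightarrow> ('a \<Rightarrow> 'b) \<Rightarrow> ('a \<Rightarrow> 'b) \<Rightarrow> enat" where
  "homotopic_distance Z Y u v =
     Inf {enat n | n. \<exists>U :: nat \<Rightarrow> 'a set.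
            (\<forall>j\<le>n. openin Z (U j)) \<and>
            (\<Union>j\<le>n. U j) = topspace Z \<and>
            (\<forall>j\<le>n. homotopic_with (\<lambda>_. True) (subtopology Z (U j)) Y u v)}"

definition subspace_distance ::
    "'a topology \<Rightarrow> 'b topology \<Rightarrow> 'a set \<Rightarrow> ('a \<Rightarrow> 'b) \<Rightarrow> ('a \<Rightarrow> 'b) \<Rightarrow> enat" where
  "subspace_distance X Y A u v = homotopic_distance (subtopology X A) Y u v"

definition null_homotopic :: "'a topology \<Rightarrow> 'b topology \<Rightarrow> ('a \<Rightarrow> 'b) \<Rightarrow> bool" where
  "null_homotopic Z Y u \<longleftrightarrow> (\<exists>c\<in>topspace Y. homotopic_with (\<lambda>_. True) Z Y u (\<lambda>_. c))"

text \<open>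
  The exponents may depend on the member of the covering. The exponent \<open>0\<close> (the identity map) is
  allowed; this does not change the value for a continuous self-map \<open>f\<close>, since then \<open>f ^^ Suc k\<close>
  is null-homotopic on a set whenever \<open>f ^^ k\<close> is.
\<close>

definition weak_category :: "'a topology \<Rightarrow> 'a set \<Rightarrow> ('a \<Rightarrow> 'a) \<Rightarrow> enat" where
  "weak_category X A f =
     Inf {enat n | n. \<exists>U :: nat \<Rightarrow> 'a set.
            (\<forall>i\<le>n. openin (subtopology X A) (U i)) \<and>
            (\<Union>i\<le>n. U i) = A \<and>
            (\<forall>i\<le>n. \<exists>k. null_homotopic (subtopology X (U i)) X (f ^^ k))}"

end

theory Submission
  imports Defs
begin

text \<open>
  Null-homotopy of \<open>f ^^ k\<close> on a set persists for larger exponents, so on a finite cover the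
  exponents may be replaced by their maximum. Hence the weak category is the infimum over \<open>k\<close> of
  the distances from \<open>f ^^ k\<close> to \<open>x0\<close>, path-connectedness making the choice of constant
  irrelevant. These distances decrease in \<open>k\<close>, so the infimum is their limit.
\<close>

text \<open>A path in \<open>Y\<close> from \<open>c\<close> to \<open>y\<close> is a homotopy
  between the two constant maps, so the constant at the end of a null-homotopy can be exchanged for
  \<open>y\<close>.\<close>

lemma null_homotopic_path_connected_iff:
  assumes "path_connected_space Y" "y \<in> topspace Y"
  shows "null_homotopic Z Y u \<longleftrightarrow> homotopic_with (\<lambda>_. True) Z Y u (\<lambda>_. y)"
proof
  assume "null_homotopic Z Y u"
  then obtain c where c: "c \<in> topspace Y" and u: "homotopic_with (\<lambda>_. True) Z Y u (\<lambda>_. c)"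
    unfolding null_homotopic_def by blast
  have "homotopic_with (\<lambda>_. True) Z Y (\<lambda>_. c) (\<lambda>_. y)"
    using assms c by (simp add: homotopic_constant_maps path_connected_space_iff_path_component)
  with u show "homotopic_with (\<lambda>_. True) Z Y u (\<lambda>_. y)"
    by (rule homotopic_with_trans)
qed (use assms in \<open>auto simp: null_homotopic_def\<close>)

lemma null_homotopic_compose_left:
  assumes "null_homotopic Z Y u" "continuous_map Y W g"
  shows "null_homotopic Z W (g \<circ> u)"
proof -
  obtain c where c: "c \<in> topspace Y" and u: "homotopic_with (\<lambda>_. True) Z Y u (\<lambda>_. c)"
    using assms(1) unfolding null_homotopic_def by blast
  have "homotopic_with (\<lambda>_. True) Z W (g \<circ> u) (g \<circ> (\<lambda>_. c))"
    using u assms(2) by (intro homotopic_with_compose_continuous_map_left) auto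
  moreover have "g c \<in> topspace W"
    using assms(2) c by (auto simp: continuous_map_def)
  ultimately show ?thesis
    unfolding null_homotopic_def by (auto simp: comp_def)
qed

text \<open>One more \<open>f\<close> on the left carries a homotopy ending at the constant
  \<open>c\<close> to one ending at \<open>f c\<close>. The end point may move, so it helps that
  \<open>null_homotopic\<close> leaves the constant free.\<close>

lemma null_homotopic_funpow_mono:
  assumes "null_homotopic Z X (f ^^ k)" "continuous_map X X f" "k \<le> m"
  shows "null_homotopic Z X (f ^^ m)"
  using assms(3)
proof (induction m rule: dec_induct)
  case base
  show ?case by (rule assms(1))
next
  case (step m)
  show ?case
    using null_homotopic_compose_left[OF step.IH assms(2)] by (simp add: comp_def)
qed

text \<open>This brings the distance to the shape of \<open>weak_category\<close>; for
  \<open>u = f ^^ k\<close> the two then differ only in whether the exponent may vary with the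
  member of the cover.\<close>

lemma subspace_distance_const_eq:
  assumes "path_connected_space Y" "y \<in> topspace Y" "A \<subseteq> topspace X"
  shows "subspace_distance X Y A u (\<lambda>_. y) =
     Inf {enat n | n. \<exists>U :: nat \<Rightarrow> 'a set.
            (\<forall>i\<le>n. openin (subtopology X A) (U i)) \<and>
            (\<Union>i\<le>n. U i) = A \<and>
            (\<forall>i\<le>n. null_homotopic (subtopology X (U i)) Y u)}"
proof -
  \<comment> \<open>The distance restricts first to \<open>A\<close> and then to a member of the
    cover, whereas the weak category restricts \<open>X\<close> to that member at once.\<close>
  have "subtopology (subtopology X A) S = subtopology X S" if "openin (subtopology X A) S" for S
    using openin_imp_subset[OF that] by (simp add: subtopology_subtopology Int_absorb1)
  moreover have "topspace (subtopology X A) = A"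
    using assms(3) by auto
  ultimately show ?thesis
    unfolding subspace_distance_def homotopic_distance_def
      null_homotopic_path_connected_iff[OF assms(1,2)]
    by (intro arg_cong[where f = Inf] Collect_cong ex_cong1 conj_cong refl) auto
qed

theorem proposition6p7:
  fixes X :: "'a topology" and x0 :: 'a and A :: "'a set" and f :: "'a \<Rightarrow> 'a"
  assumes "path_connected_space X"
    and "x0 \<in> topspace X"
    and "A \<subseteq> topspace X"
    and "continuous_map X X f"
  shows "(\<lambda>k. subspace_distance X X A (f ^^ k) (\<lambda>_. x0)) \<longlonglongrightarrow> weak_category X A f"
proof -
  define cover where "cover n U \<longleftrightarrow>
      (\<forall>i\<le>n. openin (subtopology X A) (U i)) \<and> (\<Union>i\<le>n. U i) = A" for n :: nat and U
  define null where "null k S \<longleftrightarrow> null_homotopic (subtopology X S) X (f ^^ k)" for k S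
  define N where "N k = {enat n | n. \<exists>U. cover n U \<and> (\<forall>i\<le>n. null k (U i))}" for k
  have null_mono: "null m S" if "null k S" "k \<le> m" for k m S
    using that null_homotopic_funpow_mono assms(4) unfolding null_def by blast
  have dist: "subspace_distance X X A (f ^^ k) (\<lambda>_. x0) = Inf (N k)" for k
    unfolding subspace_distance_const_eq[OF assms(1-3)] N_def cover_def null_def
    by simp
  have uniform: "(\<forall>i\<le>n. \<exists>k. null k (U i)) \<longleftrightarrow> (\<exists>k. \<forall>i\<le>n. null k (U i))"
    for n :: nat and U
  proof
    assume "\<forall>i\<le>n. \<exists>k. null k (U i)"
    then have "\<forall>i\<in>{..n}. \<exists>k. null k (U i)"
      by simp
    from bchoice[OF this] obtain k where k: "\<forall>i\<in>{..n}. null (k i) (U i)" ..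
    have "null (Max (k ` {..n})) (U i)" if "i \<le> n" for i
    proof (rule null_mono)
      show "null (k i) (U i)" "k i \<le> Max (k ` {..n})"
        using k that by auto
    qed
    then show "\<exists>k. \<forall>i\<le>n. null k (U i)"
      by blast
  qed blast
  have "weak_category X A f
      = Inf {enat n | n. \<exists>U. cover n U \<and> (\<forall>i\<le>n. \<exists>k. null k (U i))}"
    unfolding weak_category_def cover_def null_def by simp
  \<comment> \<open>By \<open>uniform\<close> a single exponent serves the whole cover, so its
    quantifier can move out past \<open>U\<close> as well and becomes the union over
    \<open>k\<close>.\<close>
  also have "{enat n | n. \<exists>U. cover n U \<and> (\<forall>i\<le>n. \<exists>k. null k (U i))} = (\<Union>k. N k)"
    unfolding uniform N_def by blast
  also have "Inf (\<Union>k. N k) = (INF k. Inf (N k))"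
  proof (rule antisym)
    show "Inf (\<Union>k. N k) \<le> (INF k. Inf (N k))"
      by (intro INF_greatest Inf_superset_mono) blast
    show "(INF k. Inf (N k)) \<le> Inf (\<Union>k. N k)"
      by (rule Inf_greatest) (blast intro: INF_lower2 Inf_lower)
  qed
  finally have wcat: "weak_category X A f = (INF k. Inf (N k))" .
  \<comment> \<open>A cover that serves the exponent \<open>k\<close> serves every larger one
    unchanged, so the sets of admissible \<open>n\<close> grow and their infima decrease.\<close>
  have "N k \<subseteq> N m" if "k \<le> m" for k m
    using null_mono[OF _ that] unfolding N_def by blast
  then have "decseq (\<lambda>k. Inf (N k))"
    unfolding decseq_def by (blast intro: Inf_superset_mono)
  \<comment> \<open>In the complete linear order \<open>enat\<close> a decreasing sequence converges
    to its infimum, so an infinite value needs no separate case.\<close>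
  then show ?thesis
    unfolding dist wcat by (rule LIMSEQ_INF)
qed

end
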